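(* If $\vdash G\triangleright N$, $G$ is bounded and $G\parallel\mathcal M$ is weakly balanced, then the session $N\parallel\mathcal M$ is input-enabling.
   Context: Participants $\mathsf p,\mathsf q,\mathsf r,\mathsf s$; labels $\lambda$. Processes are the possibly infinite but regular terms coinductively generated by $P ::= \mathbf 0 \mid \mathsf p!\{\lambda_i;P_i\}_{i\in I}\mid \mathsf p?\{\lambda_i;P_i\}_{i\in I}$, $I$ finite nonempty, $\lambda_i$ pairwise distinct. A network is $N=\mathsf p_1[\![P_1]\!]\parallel\cdots\parallel\mathsf p_n[\![P_n]\!]$ with $n>0$ and pairwise distinct $\mathsf p_i$, taken modulo permutation and adding/removing components $\mathsf p[\![\mathbf 0]\!]$; we write $\mathsf p[\![P]\!]\in N$ ($P\ne\mathbf 0$) if $N\equiv\mathsf p[\![P]\!]\parallel N'$, and $\mathrm{plays}(N)=\{\mathsf p\mid\mathsf p[\![P]\!]\in N\}$. A message is $\langle\mathsf p,\lambda,\mathsf q\rangle$; a queue $\mathcal M$ is a finite sequence of messages ($\emptyset$, $\cdot$), modulo the congruence $\equiv$ generated by $\langle\mathsf p,\lambda,\mathsf q\rangle\cdot\langle\mathsf r,\lambda',\mathsf s\rangle\equiv\langle\mathsf r,\lambda',\mathsf s\rangle\cdot\langle\mathsf p,\lambda,\mathsf q\rangle$ when $\mathsf p\neq\mathsf r$ or $\mathsf q\neq\mathsf s$. Communications $\beta::=\mathsf p\mathsf q!\lambda\mid\mathsf p\mathsf q?\lambda$ (the latter: input by $\mathsf q$ of $\lambda$ sent by $\mathsf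 p$), $\mathrm{play}(\mathsf p\mathsf q!\lambda)=\mathsf p$, $\mathrm{play}(\mathsf p\mathsf q?\lambda)=\mathsf q$. Sessions $N\parallel\mathcal M$ reduce by: $\mathsf p[\![\mathsf q!\{\lambda_i;P_i\}_{i\in I}]\!]\parallel N\parallel\mathcal M\xrightarrow{\mathsf p\mathsf q!\lambda_h}\mathsf p[\![P_h]\!]\parallel N\parallel\mathcal M\cdot\langle\mathsf p,\lambda_h,\mathsf q\rangle$ and $\mathsf q[\![\mathsf p?\{\lambda_i;Q_i\}_{i\in I}]\!]\parallel N\parallel\langle\mathsf p,\lambda_h,\mathsf q\rangle\cdot\mathcal M\xrightarrow{\mathsf p\mathsf q?\lambda_h}\mathsf q[\![Q_h]\!]\parallel N\parallel\mathcal M$, $h\in I$. Lockstep: a nonempty set $\Delta$ of communications is coherent for a session $S$ if distinct elements of $\Delta$ have distinct players and $S$ has a $\beta$-transition for each $\beta\in\Delta$; $S\Rightarrow_\Delta S'$ if $\Delta=\{\beta_1,\ldots,\beta_n\}$ is a maximal coherent set for $S$ and $S\xrightarrow{\beta_1}\cdots\xrightarrow{\beta_n}S'$. A complete lockstep computation from $S$ is a sequence $S=S_0\Rightarrow_{\Delta_0}S_1\Rightarrow_{\Delta_1}\cdots$ (indexed by $k<x$, $x\in\mathbb N\cup\{\omega\}$) which is either infinite or finite with a last session having no transition. The session $N\parallel\mathcal M$ is input-enabling if whenever $\mathsf p[\![\mathsf q?\{\lambda_i;P_i\}_{i\in I}]\!]\in N$, every complete lockstep computation from $N\parallel\mathcal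 M$ has a step $h<x$ with $\mathsf q\mathsf p?\lambda_j\in\Delta_h$ for some $j\in I$. Global types: possibly infinite regular terms $G ::= \mathsf{End}\mid \mathsf p\mathsf q!\{\lambda_i;G_i\}_{i\in I}\mid\mathsf p\mathsf q?\{\lambda_i;G_i\}_{i\in I}$ ($I$ finite nonempty, $\mathsf p\neq\mathsf q$, $\lambda_i$ distinct); $\mathsf p\mathsf q\dagger$ denotes either form. $\mathrm{play}(\mathsf p\mathsf q!\{\ldots\})=\mathsf p$, $\mathrm{play}(\mathsf p\mathsf q?\{\ldots\})=\mathsf q$; $\mathrm{plays}(G)$ least set with $\mathrm{plays}(\mathsf{End})=\emptyset$, $\mathrm{plays}(G)=\{\mathrm{play}(G)\}\cup\bigcup_i\mathrm{plays}(G_i)$. Typing $\vdash G\triangleright N$ (coinductive): (End) $\vdash\mathsf{End}\triangleright\mathsf p[\![\mathbf 0]\!]$; (Out) if $\forall i\in I$: $\vdash G_i\triangleright\mathsf p[\![P_i]\!]\parallel N$ and $\mathrm{plays}(G_i)\setminus\{\mathsf p\}=\mathrm{plays}(N)$, then $\vdash\mathsf p\mathsf q!\{\lambda_i;G_i\}_{i\in I}\triangleright\mathsf p[\![\mathsf q!\{\lambda_i;P_i\}_{i\in I}]\!]\parallel N$; (In) if $I\subseteq J$ and $\forall i\in I$: $\vdash G_i\triangleright\mathsf p[\![P_i]\!]\parallel N$ and $\mathrm{plays}(G_i)\setminus\{\mathsf p\}=\mathrm{plays}(N)$, then $\vdash\mathsf q\mathsf p?\{\lambda_i;G_i\}_{i\in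 I}\triangleright\mathsf p[\![\mathsf q?\{\lambda_j;P_j\}_{j\in J}]\!]\parallel N$. Boundedness: $\mathrm{Paths}(G)$ is the greatest family with $\mathrm{Paths}(\mathsf{End})=\{\epsilon\}$ and $\mathrm{Paths}(\mathsf p\mathsf q\dagger\{\lambda_i;G_i\}_{i\in I})=\bigcup_{i}\{\mathsf p\mathsf q\dagger\lambda_i\cdot\xi\mid\xi\in\mathrm{Paths}(G_i)\}$; $\mathrm{depth}(\xi,\mathsf p)=\inf\{n\mid\mathrm{play}(\xi_n)=\mathsf p\}$ ($\inf\emptyset=\infty$); $\mathrm{depth}(G,\mathsf p)=1+\sup\{\mathrm{depth}(\xi,\mathsf p)\mid\xi\in\mathrm{Paths}(G)\}$ if $\mathsf p\in\mathrm{plays}(G)$, else $0$. $G$ is bounded if $\mathrm{depth}(G',\mathsf p)<\infty$ for all $G'$ occurring in $G$ and all $\mathsf p\in\mathrm{plays}(G')$. Weak balancing (coinductive): $\mathsf{End}\parallel\emptyset$ is weakly balanced; $\mathsf p\mathsf q!\{\lambda_i;G_i\}_{i\in I}\parallel\mathcal M$ is if every $G_i\parallel\mathcal M\cdot\langle\mathsf p,\lambda_i,\mathsf q\rangle$ is; $\mathsf p\mathsf q?\{\lambda_i;G_i\}_{i\in I}\parallel\langle\mathsf p,\lambda_h,\mathsf q\rangle\cdot\mathcal M$ with $h\in I$ is if $G_h\parallel\mathcal M$ is. *)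

theory Defs
  imports "HOL-Library.Finite_Map" "HOL-Library.Extended_Nat"
begin

section \<open>Processes and networks\<close>

text \<open>
  Type variables: \<open>'p\<close> for participants, \<open>'l\<close> for labels.
  A branching \<open>{\<lambda>\<^sub>i; P\<^sub>i}\<^sub>i\<^sub>\<in>\<^sub>I\<close> with \<open>I\<close> finite and pairwise distinct labels is a finite map from
  labels to continuations.  Nonemptiness of \<open>I\<close> and regularity of the term are imposed by the
  predicate \<open>process\<close>.
\<close>

codatatype ('p, 'l) proc =
    Inact
  | Send 'p "('l, ('p, 'l) proc) fmap"
  | Recv 'p "('l, ('p, 'l) proc) fmap"

inductive psubterm :: "('p, 'l) proc \<Rightarrow> ('p, 'l) proc \<Rightarrow> bool" where
  "psubterm P P"
| "fmlookup Ps l = Some P \<Longrightarrow> psubterm Q P \<Longrightarrow> psubterm Q (Send p Ps)"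
| "fmlookup Ps l = Some P \<Longrightarrow> psubterm Q P \<Longrightarrow> psubterm Q (Recv p Ps)"

definition process :: "('p, 'l) proc \<Rightarrow> bool" where
  "process P \<longleftrightarrow>
     finite {Q. psubterm Q P} \<and>
     (\<forall>p Ps. psubterm (Send p Ps) P \<or> psubterm (Recv p Ps) P \<longrightarrow> Ps \<noteq> fmempty)"

text \<open>
  Modulo permutation and adding or removing components \<open>p[[0]]\<close>, a network is a finitely supported
  assignment of processes to participants, where the absent participants are mapped to \<open>Inact\<close>.
  The parallel composition \<open>p[[P]] \<parallel> N\<close>, in which \<open>p\<close> is not among the participants
  of \<open>N\<close>, is \<open>N(p := P)\<close> with \<open>N p = Inact\<close>.
\<close>

type_synonym ('p, 'l) net = "'p \<Rightarrow> ('p, 'l) proc"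

definition nplays :: "('p, 'l) net \<Rightarrow> 'p set" where
  "nplays N = {p. N p \<noteq> Inact}"

definition network :: "('p, 'l) net \<Rightarrow> bool" where
  "network N \<longleftrightarrow> finite (nplays N) \<and> (\<forall>p. process (N p))"


section \<open>Queues\<close>

text \<open>The message \<open>\<langle>p, \<lambda>, q\<rangle>\<close> (sender, label, receiver) is the triple \<open>(p, \<lambda>, q)\<close>.\<close>

type_synonym ('p, 'l) msg = "'p \<times> 'l \<times> 'p"

inductive qcong :: "('p, 'l) msg list \<Rightarrow> ('p, 'l) msg list \<Rightarrow> bool" where
  qcong_swap: "p \<noteq> r \<or> q \<noteq> s \<Longrightarrow> qcong [(p, l, q), (r, l', s)] [(r, l', s), (p, l, q)]"
| qcong_append: "qcong xs xs' \<Longrightarrow> qcong ys ys' \<Longrightarrow> qcong (xs @ ys) (xs' @ ys')"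
| qcong_refl: "qcong xs xs"
| qcong_sym: "qcong xs ys \<Longrightarrow> qcong ys xs"
| qcong_trans: "qcong xs ys \<Longrightarrow> qcong ys zs \<Longrightarrow> qcong xs zs"

quotient_type ('p, 'l) queue = "('p, 'l) msg list" / qcong
  by (rule equivpI) (auto intro!: reflpI sympI transpI intro: qcong_refl qcong_sym qcong_trans)

lift_definition qempty :: "('p, 'l) queue" is "[]" .

lift_definition qsingle :: "('p, 'l) msg \<Rightarrow> ('p, 'l) queue" is "\<lambda>m. [m]" .

lift_definition qapp :: "('p, 'l) queue \<Rightarrow> ('p, 'l) queue \<Rightarrow> ('p, 'l) queue"  (infixr "\<cdot>" 65)
  is "(@)" by (rule qcong_append)


section \<open>Sessions and their transitions\<close>

text \<open>\<open>COut p q \<lambda>\<close> is \<open>pq!\<lambda>\<close>, and \<open>CIn p q \<lambda>\<close> is \<open>pq?\<lambda>\<close>: the input by \<open>q\<close> of \<open>\<lambda>\<close> sent by \<open>p\<close>.\<close>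

datatype ('p, 'l) comm = COut 'p 'p 'l | CIn 'p 'p 'l

fun play :: "('p, 'l) comm \<Rightarrow> 'p" where
  "play (COut p q l) = p"
| "play (CIn p q l) = q"

type_synonym ('p, 'l) session = "('p, 'l) net \<times> ('p, 'l) queue"

inductive step :: "('p, 'l) session \<Rightarrow> ('p, 'l) comm \<Rightarrow> ('p, 'l) session \<Rightarrow> bool" where
  step_out: "N p = Send q Ps \<Longrightarrow> fmlookup Ps l = Some P \<Longrightarrow>
    step (N, M) (COut p q l) (N(p := P), M \<cdot> qsingle (p, l, q))"
| step_in: "N q = Recv p Qs \<Longrightarrow> fmlookup Qs l = Some Q \<Longrightarrow>
    step (N, qsingle (p, l, q) \<cdot> M) (CIn p q l) (N(q := Q), M)"

inductive steps :: "('p, 'l) session \<Rightarrow> ('p, 'l) comm list \<Rightarrow> ('p, 'l) session \<Rightarrow> bool" where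
  "steps S [] S"
| "step S b S' \<Longrightarrow> steps S' bs S'' \<Longrightarrow> steps S (b # bs) S''"


section \<open>Lockstep computations and input-enabling\<close>

definition coherent :: "('p, 'l) session \<Rightarrow> ('p, 'l) comm set \<Rightarrow> bool" where
  "coherent S D \<longleftrightarrow> D \<noteq> {} \<and> inj_on play D \<and> (\<forall>b\<in>D. \<exists>S'. step S b S')"

definition maximal_coherent :: "('p, 'l) session \<Rightarrow> ('p, 'l) comm set \<Rightarrow> bool" where
  "maximal_coherent S D \<longleftrightarrow> coherent S D \<and> (\<forall>D'. coherent S D' \<and> D \<subseteq> D' \<longrightarrow> D' = D)"

definition lockstep ::
  "('p, 'l) session \<Rightarrow> ('p, 'l) comm set \<Rightarrow> ('p, 'l) session \<Rightarrow> bool" where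
  "lockstep S D S' \<longleftrightarrow>
     maximal_coherent S D \<and> (\<exists>bs. distinct bs \<and> set bs = D \<and> steps S bs S')"

text \<open>
  A computation with \<open>x\<close> steps \<open>Ss k \<Rightarrow>\<^bsub>Ds k\<^esub> Ss (k + 1)\<close>, \<open>k < x\<close>; if \<open>x = enat n\<close> then the last
  session is \<open>Ss n\<close>.  The values of \<open>Ss\<close> and \<open>Ds\<close> at larger indices are irrelevant.
\<close>

definition complete_lockstep ::
  "('p, 'l) session \<Rightarrow> enat \<Rightarrow> (nat \<Rightarrow> ('p, 'l) session) \<Rightarrow> (nat \<Rightarrow> ('p, 'l) comm set) \<Rightarrow> bool"
  where
  "complete_lockstep S x Ss Ds \<longleftrightarrow>
     Ss 0 = S \<and>
     (\<forall>k. enat k < x \<longrightarrow> lockstep (Ss k) (Ds k) (Ss (Suc k))) \<and>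
     (\<forall>n. x = enat n \<longrightarrow> \<not> (\<exists>b S'. step (Ss n) b S'))"

definition input_enabling :: "('p, 'l) net \<Rightarrow> ('p, 'l) queue \<Rightarrow> bool" where
  "input_enabling N M \<longleftrightarrow>
     (\<forall>p q Ps. N p = Recv q Ps \<longrightarrow>
        (\<forall>x Ss Ds. complete_lockstep (N, M) x Ss Ds \<longrightarrow>
           (\<exists>h. enat h < x \<and> (\<exists>l\<in>fmdom' Ps. CIn q p l \<in> Ds h))))"


section \<open>Global types\<close>

text \<open>\<open>GOut p q Gs\<close> is \<open>pq!{\<lambda>\<^sub>i; G\<^sub>i}\<close>, and \<open>GIn p q Gs\<close> is \<open>pq?{\<lambda>\<^sub>i; G\<^sub>i}\<close> (input by \<open>q\<close> from \<open>p\<close>).\<close>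

codatatype ('p, 'l) gtype =
    End
  | GOut 'p 'p "('l, ('p, 'l) gtype) fmap"
  | GIn 'p 'p "('l, ('p, 'l) gtype) fmap"

inductive gsubterm :: "('p, 'l) gtype \<Rightarrow> ('p, 'l) gtype \<Rightarrow> bool" where
  "gsubterm G G"
| "fmlookup Gs l = Some G \<Longrightarrow> gsubterm G' G \<Longrightarrow> gsubterm G' (GOut p q Gs)"
| "fmlookup Gs l = Some G \<Longrightarrow> gsubterm G' G \<Longrightarrow> gsubterm G' (GIn p q Gs)"

definition global_type :: "('p, 'l) gtype \<Rightarrow> bool" where
  "global_type G \<longleftrightarrow>
     finite {G'. gsubterm G' G} \<and>
     (\<forall>p q Gs. gsubterm (GOut p q Gs) G \<or> gsubterm (GIn p q Gs) G \<longrightarrow> p \<noteq> q \<and> Gs \<noteq> fmempty)"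

inductive in_gplays :: "'p \<Rightarrow> ('p, 'l) gtype \<Rightarrow> bool" where
  "in_gplays p (GOut p q Gs)"
| "in_gplays q (GIn p q Gs)"
| "fmlookup Gs l = Some G \<Longrightarrow> in_gplays r G \<Longrightarrow> in_gplays r (GOut p q Gs)"
| "fmlookup Gs l = Some G \<Longrightarrow> in_gplays r G \<Longrightarrow> in_gplays r (GIn p q Gs)"

definition gplays :: "('p, 'l) gtype \<Rightarrow> 'p set" where
  "gplays G = {p. in_gplays p G}"

coinductive typing :: "('p, 'l) gtype \<Rightarrow> ('p, 'l) net \<Rightarrow> bool"  ("\<turnstile> _ \<triangleright> _" [60, 60] 50) where
  typing_End: "\<turnstile> End \<triangleright> (\<lambda>_. Inact)"
| typing_Out:
    "N p = Inact \<Longrightarrow>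
     fmdom' Gs = fmdom' Ps \<Longrightarrow>
     (\<forall>l G P. fmlookup Gs l = Some G \<longrightarrow> fmlookup Ps l = Some P \<longrightarrow>
        \<turnstile> G \<triangleright> (N(p := P)) \<and> gplays G - {p} = nplays N) \<Longrightarrow>
     \<turnstile> GOut p q Gs \<triangleright> (N(p := Send q Ps))"
| typing_In:
    "N p = Inact \<Longrightarrow>
     fmdom' Gs \<subseteq> fmdom' Ps \<Longrightarrow>
     (\<forall>l G P. fmlookup Gs l = Some G \<longrightarrow> fmlookup Ps l = Some P \<longrightarrow>
        \<turnstile> G \<triangleright> (N(p := P)) \<and> gplays G - {p} = nplays N) \<Longrightarrow>
     \<turnstile> GIn q p Gs \<triangleright> (N(p := Recv q Ps))"


section \<open>Boundedness\<close>

text \<open>Finite or infinite sequences.\<close>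

codatatype 'a trace = TNil | TCons 'a "'a trace"

fun tnth :: "'a trace \<Rightarrow> nat \<Rightarrow> 'a option" where
  "tnth xs 0 = (case xs of TNil \<Rightarrow> None | TCons a _ \<Rightarrow> Some a)"
| "tnth xs (Suc n) = (case xs of TNil \<Rightarrow> None | TCons _ ys \<Rightarrow> tnth ys n)"

coinductive is_path :: "('p, 'l) gtype \<Rightarrow> ('p, 'l) comm trace \<Rightarrow> bool" where
  "is_path End TNil"
| "fmlookup Gs l = Some G \<Longrightarrow> is_path G xs \<Longrightarrow> is_path (GOut p q Gs) (TCons (COut p q l) xs)"
| "fmlookup Gs l = Some G \<Longrightarrow> is_path G xs \<Longrightarrow> is_path (GIn p q Gs) (TCons (CIn p q l) xs)"

definition Paths :: "('p, 'l) gtype \<Rightarrow> ('p, 'l) comm trace set" where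
  "Paths G = {xs. is_path G xs}"

text \<open>
  Positions are counted from \<open>0\<close>, so that the player of the root of \<open>G\<close> has depth \<open>1\<close> in \<open>G\<close>.
  On \<open>enat\<close>, \<open>Inf {} = \<infinity>\<close>.
\<close>

definition tdepth :: "('p, 'l) comm trace \<Rightarrow> 'p \<Rightarrow> enat" where
  "tdepth xs p = Inf {enat n | n. \<exists>b. tnth xs n = Some b \<and> play b = p}"

definition depth :: "('p, 'l) gtype \<Rightarrow> 'p \<Rightarrow> enat" where
  "depth G p = (if p \<in> gplays G then 1 + (SUP xs\<in>Paths G. tdepth xs p) else 0)"

definition bounded_gtype :: "('p, 'l) gtype \<Rightarrow> bool" where
  "bounded_gtype G \<longleftrightarrow> (\<forall>G'. gsubterm G' G \<longrightarrow> (\<forall>p\<in>gplays G'. depth G' p < \<infinity>))"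


section \<open>Weak balancing\<close>

coinductive weakly_balanced :: "('p, 'l) gtype \<Rightarrow> ('p, 'l) queue \<Rightarrow> bool" where
  wb_End: "weakly_balanced End qempty"
| wb_Out:
    "(\<forall>l G. fmlookup Gs l = Some G \<longrightarrow> weakly_balanced G (M \<cdot> qsingle (p, l, q))) \<Longrightarrow>
     weakly_balanced (GOut p q Gs) M"
| wb_In:
    "fmlookup Gs h = Some G \<Longrightarrow> weakly_balanced G M \<Longrightarrow>
     weakly_balanced (GIn p q Gs) (qsingle (p, h, q) \<cdot> M)"

end

theory Submission
  imports Defs
begin

text \<open>
  A global type typing \<open>N\<close> and weakly balanced with \<open>M\<close> is a schedule for \<open>N \<parallel> M\<close>: its root names a
  participant that can move now, and whatever that participant does, a schedule remains for the
  resulting session.  Boundedness equips each node with ranks (the depths) that decrease strictly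
  for every other active participant when the root is consumed.  A move of a participant other than
  the root can be anticipated inside the schedule without increasing any other rank and without
  changing the root; unbalanced branches of an input are discarded.  A maximal coherent set
  contains a communication of the root, so each lockstep lowers the rank of a waiting participant,
  which therefore eventually moves.
\<close>

section \<open>Queues\<close>

definition channel :: "('p, 'l) msg \<Rightarrow> 'p \<times> 'p" where
  "channel m = (fst m, snd (snd m))"

lemma channel_simp [simp]: "channel (p, l, q) = (p, q)"
  by (simp add: channel_def)

text \<open>Messages commute exactly when their channels differ, so the subsequences on the
  individual channels form a complete invariant of the congruence.\<close>

definition on_channel :: "'p \<times> 'p \<Rightarrow> ('p, 'l) msg list \<Rightarrow> ('p, 'l) msg list" where
  "on_channel c = filter (\<lambda>m. channel m = c)"

lemma qcong_on_channel: "qcong xs ys \<Longrightarrow> on_channel c xs = on_channel c ys"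
  by (induction rule: qcong.induct) (auto simp: on_channel_def)

lemma qcong_Cons: "qcong xs ys \<Longrightarrow> qcong (x # xs) (x # ys)"
  using qcong_append[OF qcong_refl[of "[x]"]] by simp

text \<open>Every message of the prefix lies on another channel, so \<open>x\<close> can be swapped
  past them one at a time.\<close>

lemma qcong_move_front:
  "on_channel (channel x) as = [] \<Longrightarrow> qcong (as @ x # bs) (x # as @ bs)"
proof (induction as)
  case Nil
  then show ?case by (simp add: qcong_refl)
next
  case (Cons a as)
  then have ne: "channel a \<noteq> channel x" and "on_channel (channel x) as = []"
    by (auto simp: on_channel_def split: if_splits)
  then have "qcong (a # as @ x # bs) (a # x # as @ bs)"
    using Cons.IH qcong_Cons by blast
  moreover have "qcong [a, x] [x, a]"
    using ne qcong_swap[of "fst a" "fst x" "snd (snd a)" "snd (snd x)" "fst (snd a)" "fst (snd x)"]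
    by (auto simp: channel_def prod_eq_iff)
  then have "qcong ([a, x] @ as @ bs) ([x, a] @ as @ bs)"
    by (rule qcong_append[OF _ qcong_refl])
  ultimately show ?case using qcong_trans by fastforce
qed

lemma qcong_head:
  assumes "on_channel (channel x) ys = x # zs"
  shows "\<exists>ys'. qcong ys (x # ys')"
proof -
  obtain as bs where "ys = as @ x # bs" "on_channel (channel x) as = []"
    using assms filter_eq_ConsD[of "\<lambda>m. channel m = channel x" ys x zs]
    by (auto simp: on_channel_def filter_empty_conv)
  then show ?thesis using qcong_move_front by blast
qed

text \<open>The head \<open>x\<close> of the first list is also the first message of its channel in
  the other list, so it can be moved to the front there. The remainders again agree on every
  channel.\<close>

lemma on_channel_qcong:
  "(\<And>c. on_channel c xs = on_channel c ys) \<Longrightarrow> qcong xs ys"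
proof (induction xs arbitrary: ys)
  case Nil
  \<comment> \<open>A nonempty \<open>ys\<close> would leave its own head on this channel; for empty
    \<open>ys\<close> the unspecified value of \<open>hd\<close> is harmless.\<close>
  have "on_channel (channel (hd ys)) ys = []"
    using Nil[of "channel (hd ys)"] by (simp add: on_channel_def)
  then have "ys = []" by (cases ys) (auto simp: on_channel_def)
  then show ?case by (simp add: qcong_refl)
next
  case (Cons x xs)
  have "on_channel (channel x) ys = x # on_channel (channel x) xs"
    using Cons.prems[of "channel x"] by (simp add: on_channel_def)
  then obtain ys' where ys': "qcong ys (x # ys')" using qcong_head by blast
  have "on_channel c xs = on_channel c ys'" for c
    using Cons.prems[of c] qcong_on_channel[OF ys', of c]
    by (simp add: on_channel_def split: if_splits)
  then have "qcong (x # xs) (x # ys')" using Cons.IH qcong_Cons by blast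
  then show ?case using ys' qcong_sym qcong_trans by blast
qed

lemma qcong_iff: "qcong xs ys \<longleftrightarrow> (\<forall>c. on_channel c xs = on_channel c ys)"
  using qcong_on_channel on_channel_qcong by metis

section \<open>Cancellation and exchange of head messages\<close>

lemma qapp_assoc: "(A \<cdot> B) \<cdot> C = A \<cdot> B \<cdot> C"
  by transfer (simp add: qcong_refl)

lemma qapp_single_cancel: "qsingle m \<cdot> A = qsingle m \<cdot> B \<longleftrightarrow> A = B"
  by transfer (auto simp: qcong_iff on_channel_def split: if_splits)

lemma qsingle_commute:
  "channel m \<noteq> channel m' \<Longrightarrow> qsingle m \<cdot> qsingle m' = qsingle m' \<cdot> qsingle m"
  by transfer (auto simp: qcong_iff on_channel_def)

lemma qhead_unique:
  "qsingle m \<cdot> A = qsingle m' \<cdot> B \<Longrightarrow> channel m = channel m' \<Longrightarrow> m = m'"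
  by transfer (auto simp: qcong_iff on_channel_def dest!: spec[of _ "channel _"] split: if_splits)

text \<open>Heads on different channels do not interfere: each is still available once the other is
  removed, and both orders of removal leave the same \<open>C\<close>. The remainder
  \<open>B\<close> is found by cancelling \<open>m'\<close>.\<close>

lemma qhead_swap:
  assumes "qsingle m \<cdot> A = qsingle m' \<cdot> B" and "channel m \<noteq> channel m'"
  shows "\<exists>C. A = qsingle m' \<cdot> C \<and> B = qsingle m \<cdot> C"
proof -
  have "\<exists>C. A = qsingle m' \<cdot> C"
    using assms
  proof transfer
    fix m m' :: "('p, 'l) msg" and A B
    assume "qcong ([m] @ A) ([m'] @ B)" "channel m \<noteq> channel m'"
    then have "on_channel (channel m') ([m] @ A) = on_channel (channel m') ([m'] @ B)"
      by (simp only: qcong_iff)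
    then have "on_channel (channel m') A = m' # on_channel (channel m') B"
      using \<open>channel m \<noteq> channel m'\<close> by (simp add: on_channel_def)
    then show "\<exists>C. qcong A ([m'] @ C)" using qcong_head by fastforce
  qed
  then obtain C where C: "A = qsingle m' \<cdot> C" by blast
  have "qsingle m' \<cdot> B = qsingle m' \<cdot> (qsingle m \<cdot> C)"
    using assms C qsingle_commute[OF assms(2)] by (metis qapp_assoc)
  then show ?thesis using C qapp_single_cancel by blast
qed

section \<open>Independence of transitions\<close>

lemma step_player_active: "step (N, M) b (N', M') \<Longrightarrow> N (play b) \<noteq> Inact"
  by (auto elim: step.cases)

lemma step_others: "step (N, M) b (N', M') \<Longrightarrow> r \<noteq> play b \<Longrightarrow> N' r = N r"
  by (auto elim: step.cases)

text \<open>A send appends at the back, which leaves every head message in place; two sends by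
  different players use different channels, so their messages commute.\<close>

lemma step_after_send:
  assumes "step (N, M) b (N', M')" and "play b \<noteq> p"
  shows "step (N(p := P), M \<cdot> qsingle (p, l, q)) b (N'(p := P), M' \<cdot> qsingle (p, l, q))"
  using assms(1)
proof cases
  case (step_out s t Ps m Q)
  have "M' \<cdot> qsingle (p, l, q) = (M \<cdot> qsingle (p, l, q)) \<cdot> qsingle (s, m, t)"
    using step_out assms(2) qsingle_commute[of "(p, l, q)" "(s, m, t)"] by (simp add: qapp_assoc)
  then show ?thesis
    using step_out assms(2) step.step_out[of "N(p := P)" s t Ps m Q]
    by (simp add: fun_upd_twist)
next
  case (step_in s t Qs m Q)
  then show ?thesis
    using assms(2) step.step_in[of "N(p := P)" s t Qs m Q]
    by (simp add: fun_upd_twist qapp_assoc)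
qed

text \<open>The message for \<open>p\<close> stays at the front, since another receiver reads a
  different channel and a send only appends at the back.\<close>

lemma step_after_recv:
  assumes "step (N, qsingle (q, l, p) \<cdot> M) b (N', M')" and "play b \<noteq> p"
  shows "\<exists>M''. M' = qsingle (q, l, p) \<cdot> M'' \<and> step (N(p := P), M) b (N'(p := P), M'')"
  using assms(1)
proof cases
  case (step_out s t Ps m Q)
  then show ?thesis
    using assms(2) step.step_out[of "N(p := P)" s t Ps m Q M]
    by (auto simp add: fun_upd_twist qapp_assoc)
next
  case (step_in s t Qs m Q)
  have "s \<noteq> p" using step_in assms(2) by simp
  then obtain C where "M = qsingle (t, m, s) \<cdot> C" "M' = qsingle (q, l, p) \<cdot> C"
    using qhead_swap[of "(q, l, p)" M "(t, m, s)" M'] step_in by auto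
  then show ?thesis
    using step_in \<open>s \<noteq> p\<close> step.step_in[of "N(p := P)" s t Qs m Q C]
    by (auto simp add: fun_upd_twist)
qed

section \<open>Schedules\<close>

text \<open>Network and queue replace the global type, so that closure under arbitrary moves can be
  stated. The number \<open>f r\<close> bounds how many roots precede an active \<open>r\<close>;
  \<open>f p\<close> is unconstrained because \<open>p\<close> moves next. An output needs a
  continuation for every label, as the sender chooses; an input only for the label heading its
  channel.\<close>

coinductive scheduled ::
  "'p \<Rightarrow> ('p \<Rightarrow> nat) \<Rightarrow> ('p, 'l) net \<Rightarrow> ('p, 'l) queue \<Rightarrow> bool" where
  scheduled_End: "scheduled p f (\<lambda>_. Inact) M"
| scheduled_Out:
    "N p = Send q Ps \<Longrightarrow> Ps \<noteq> fmempty \<Longrightarrow>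
     (\<forall>l P. fmlookup Ps l = Some P \<longrightarrow>
        (\<exists>p' f'. scheduled p' f' (N(p := P)) (M \<cdot> qsingle (p, l, q)) \<and>
           (\<forall>r. r \<noteq> p \<longrightarrow> N r \<noteq> Inact \<longrightarrow> f' r < f r))) \<Longrightarrow>
     scheduled p f N M"
| scheduled_In:
    "N p = Recv q Ps \<Longrightarrow> fmlookup Ps l = Some P \<Longrightarrow>
     scheduled p' f' (N(p := P)) M \<Longrightarrow>
     (\<forall>r. r \<noteq> p \<longrightarrow> N r \<noteq> Inact \<longrightarrow> f' r < f r) \<Longrightarrow>
     scheduled p f N (qsingle (q, l, p) \<cdot> M)"

lemma scheduled_root_step:
  assumes "scheduled p f N M" and "N r \<noteq> Inact"
  shows "\<exists>b S'. play b = p \<and> step (N, M) b S'"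
  using assms(1)
proof cases
  case scheduled_End
  then show ?thesis using assms(2) by simp
next
  case (scheduled_Out q Ps)
  then obtain l P where "fmlookup Ps l = Some P"
    by (metis fmap_ext fmempty_lookup not_None_eq)
  then show ?thesis using scheduled_Out step_out by (metis play.simps(1))
next
  case (scheduled_In q Ps l P p' f' M')
  then show ?thesis using step_in by (metis play.simps(2))
qed

text \<open>A move of the root selects a branch. Any other mover has smaller rank in every branch,
  so by induction on its rank its move is anticipated there, and the old root is put back on top.
  Only the mover's own rank may grow.\<close>

lemma scheduled_step:
  assumes "scheduled p f N M" and "step (N, M) b (N', M')"
  shows "\<exists>p' f'. scheduled p' f' N' M' \<and> (play b \<noteq> p \<longrightarrow> p' = p) \<and>
    (\<forall>r. r \<noteq> play b \<longrightarrow> N r \<noteq> Inact \<longrightarrow> f' r \<le> f r \<and> (play b = p \<longrightarrow> f' r < f r))"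
  using assms
proof (induction "f (play b)" arbitrary: p f N M N' M' rule: less_induct)
  case less
  let ?s = "play b"
  have active: "N ?s \<noteq> Inact" using less.prems step_player_active by blast
  have others: "N' r = N r" if "r \<noteq> ?s" for r using less.prems step_others that by metis
  show ?case
    using less.prems(1)
  proof cases
    case scheduled_End
    then show ?thesis using active by simp
  next
    case (scheduled_Out q Ps)
    note branches = scheduled_Out(3)
    show ?thesis
    proof (cases "?s = p")
      case True
      from less.prems(2) obtain l P where
        "fmlookup Ps l = Some P" "N' = N(p := P)" "M' = M \<cdot> qsingle (p, l, q)"
        using True scheduled_Out(1) by cases auto
      then obtain p' f' where "scheduled p' f' N' M'"
        "\<forall>r. r \<noteq> p \<longrightarrow> N r \<noteq> Inact \<longrightarrow> f' r < f r"
        using branches by blast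
      then show ?thesis using True less_imp_le by metis
    next
      case False
      have branch: "\<exists>p' g. scheduled p' g (N'(p := P)) (M' \<cdot> qsingle (p, l, q)) \<and>
          (\<forall>r. r \<noteq> p \<longrightarrow> r \<noteq> ?s \<longrightarrow> N r \<noteq> Inact \<longrightarrow> g r < f r)"
        if P: "fmlookup Ps l = Some P" for l P
      proof -
        obtain p' f' where f': "scheduled p' f' (N(p := P)) (M \<cdot> qsingle (p, l, q))"
          "\<forall>r. r \<noteq> p \<longrightarrow> N r \<noteq> Inact \<longrightarrow> f' r < f r"
          using branches P by blast
        \<comment> \<open>The mover is active and is not the root, so the induction measure
          drops.\<close>
        have "f' ?s < f ?s" using f'(2) False active by blast
        from less.hyps[OF this f'(1) step_after_send[OF less.prems(2) False]]
        obtain p'' g where g: "scheduled p'' g (N'(p := P)) (M' \<cdot> qsingle (p, l, q))"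
          "\<forall>r. r \<noteq> ?s \<longrightarrow> (N(p := P)) r \<noteq> Inact \<longrightarrow> g r \<le> f' r"
          by blast
        have "g r < f r" if "r \<noteq> p" "r \<noteq> ?s" "N r \<noteq> Inact" for r
          using g(2) f'(2) that by (metis fun_upd_other le_less_trans)
        then show ?thesis using g(1) by blast
      qed
      \<comment> \<open>Since \<open>l\<close> determines \<open>P\<close>, the ranks can be chosen
        as a function of the label alone.\<close>
      have "\<forall>l. \<exists>g. \<forall>P. fmlookup Ps l = Some P \<longrightarrow>
          (\<exists>p'. scheduled p' g (N'(p := P)) (M' \<cdot> qsingle (p, l, q))) \<and>
          (\<forall>r. r \<noteq> p \<longrightarrow> r \<noteq> ?s \<longrightarrow> N r \<noteq> Inact \<longrightarrow> g r < f r)"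
        using branch by (metis option.inject)
      from choice[OF this] obtain g where g: "\<And>l P. fmlookup Ps l = Some P \<Longrightarrow>
          (\<exists>p'. scheduled p' (g l) (N'(p := P)) (M' \<cdot> qsingle (p, l, q))) \<and>
          (\<forall>r. r \<noteq> p \<longrightarrow> r \<noteq> ?s \<longrightarrow> N r \<noteq> Inact \<longrightarrow> g l r < f r)"
        by blast
      \<comment> \<open>The mover's new rank must exceed its rank in all branches at once; the sum
        over the finitely many labels serves as an upper bound.\<close>
      define f' where "f' = f(?s := Suc (\<Sum>l\<in>fmdom' Ps. g l ?s))"
      have "g l ?s < f' ?s" if "fmlookup Ps l = Some P" for l P
        using member_le_sum[of l "fmdom' Ps" "\<lambda>l. g l ?s"] that
        by (simp add: f'_def fmdom'I less_Suc_eq_le)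
      then have "g l r < f' r" if "fmlookup Ps l = Some P" "r \<noteq> p" "N' r \<noteq> Inact" for l P r
        using g[OF that(1)] that others by (cases "r = ?s") (auto simp: f'_def)
      moreover have "N' p = Send q Ps" using False others scheduled_Out(1) by auto
      ultimately have "scheduled p f' N' M'"
        using g scheduled_Out(2) by (intro scheduled.scheduled_Out) blast+
      moreover have "f' r \<le> f r" if "r \<noteq> ?s" for r using that by (simp add: f'_def)
      ultimately show ?thesis using False by blast
    qed
  next
    case (scheduled_In q Ps l P p' f' M0)
    show ?thesis
    proof (cases "?s = p")
      case True
      from less.prems(2) obtain l' P' where in':
        "fmlookup Ps l' = Some P'" "N' = N(p := P')" "M = qsingle (q, l', p) \<cdot> M'"
        using True scheduled_In(2) by cases auto
      \<comment> \<open>\<open>Ps\<close> may offer further labels, but the queue is first-in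
        first-out on each channel, so only the scheduled one can be received.\<close>
      then have "l' = l" using qhead_unique[of "(q, l', p)" M' "(q, l, p)" M0] scheduled_In(1) by auto
      then have "M' = M0" "P' = P"
        using in' scheduled_In(1,3) qapp_single_cancel[of "(q, l, p)" M' M0] by auto
      then show ?thesis using True in' scheduled_In less_imp_le by metis
    next
      case False
      obtain M'' where M'': "M' = qsingle (q, l, p) \<cdot> M''"
        "step (N(p := P), M0) b (N'(p := P), M'')"
        using step_after_recv less.prems(2) False scheduled_In(1) by metis
      have "f' ?s < f ?s" using scheduled_In(5) False active by blast
      from less.hyps[OF this scheduled_In(4) M''(2)]
      obtain p'' g where g: "scheduled p'' g (N'(p := P)) M''"
        "\<forall>r. r \<noteq> ?s \<longrightarrow> (N(p := P)) r \<noteq> Inact \<longrightarrow> g r \<le> f' r"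
        by blast
      define h where "h = f(?s := Suc (g ?s))"
      have "g r < h r" if "r \<noteq> p" "N' r \<noteq> Inact" for r
        using that g(2) scheduled_In(5) others[of r]
        by (cases "r = ?s") (auto simp: h_def dest!: spec[of _ r])
      moreover have "N' p = Recv q Ps" using False others scheduled_In(2) by auto
      ultimately have "scheduled p h N' M'"
        unfolding M''(1) using scheduled.scheduled_In[OF _ scheduled_In(3) g(1), of q h] by blast
      moreover have "h r \<le> f r" if "r \<noteq> ?s" for r using that by (simp add: h_def)
      ultimately show ?thesis using False by blast
    qed
  qed
qed

section \<open>Transition sequences and lockstep computations of scheduled sessions\<close>

text \<open>The root stays \<open>p\<close> until \<open>p\<close> moves, and that move strictly
  lowers the rank of the idle participant \<open>r\<close>; no other move raises it.\<close>

lemma scheduled_steps: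
  assumes "steps (N, M) bs (N', M')" and "scheduled p f N M"
    and "r \<notin> play ` set bs" and "N r \<noteq> Inact"
  shows "N' r = N r \<and> (\<exists>p' f'. scheduled p' f' N' M' \<and> f' r \<le> f r \<and>
    (p \<in> play ` set bs \<longrightarrow> f' r < f r))"
  using assms
proof (induction "(N, M)" bs "(N', M')" arbitrary: N M p f rule: steps.induct)
  case 1
  then show ?case by auto
next
  case (2 b S1 bs)
  obtain N1 M1 where S1: "S1 = (N1, M1)" by force
  have r: "r \<noteq> play b" "r \<notin> play ` set bs" using "2.prems"(2) by auto
  then have N1: "N1 r = N r" using step_others "2.hyps"(1) S1 by metis
  obtain p1 f1 where 1: "scheduled p1 f1 N1 M1" "play b \<noteq> p \<longrightarrow> p1 = p"
    "f1 r \<le> f r" "play b = p \<longrightarrow> f1 r < f r"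
    using scheduled_step[OF "2.prems"(1)] "2.hyps"(1) S1 r "2.prems"(3) by metis
  obtain p2 f2 where "N' r = N1 r" "scheduled p2 f2 N' M'" "f2 r \<le> f1 r"
    "p1 \<in> play ` set bs \<longrightarrow> f2 r < f1 r"
    using "2.hyps"(3)[OF S1 1(1) r(2)] N1 "2.prems"(3) by auto
  \<comment> \<open>Either the first move is by the root and the drop occurs now, or the root is
    still \<open>p\<close> and the drop occurs in the rest.\<close>
  moreover have "f2 r < f r" if "p \<in> play ` set (b # bs)"
    using that 1 calculation by (cases "play b = p") auto
  ultimately show ?case using 1 N1 le_trans by metis
qed

text \<open>An enabled communication of a missing player could be added to \<open>D\<close> without
  breaking coherence.\<close>

lemma maximal_coherent_player:
  assumes "maximal_coherent S D" and "step S b S'"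
  shows "play b \<in> play ` D"
proof (rule ccontr)
  assume "play b \<notin> play ` D"
  moreover have D: "inj_on play D" "\<forall>c\<in>D. \<exists>S'. step S c S'"
    using assms(1) unfolding maximal_coherent_def coherent_def by blast+
  ultimately have "inj_on play (insert b D)" by auto
  moreover have "\<forall>c\<in>insert b D. \<exists>S'. step S c S'" using D(2) assms(2) by blast
  ultimately have "coherent S (insert b D)" unfolding coherent_def by blast
  then have "insert b D = D" using assms(1) unfolding maximal_coherent_def by blast
  then show False using \<open>play b \<notin> play ` D\<close> by blast
qed

text \<open>Descent on the rank of \<open>r\<close>: the root is enabled, so it plays in the maximal
  set; hence either \<open>r\<close> plays too or its rank drops. Taking the first such lockstep
  keeps the process of \<open>r\<close> unchanged up to it.\<close>

lemma scheduled_eventually_moves: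
  assumes "complete_lockstep S x Ss Ds"
    and "scheduled p f N M" and "Ss k = (N, M)" and "enat k \<le> x" and "N r \<noteq> Inact"
  shows "\<exists>h N' M' b. enat h < x \<and> b \<in> Ds h \<and> Ss h = (N', M') \<and> N' r = N r \<and>
    play b = r \<and> (\<exists>S'. step (N', M') b S')"
  using assms(2-)
proof (induction "f r" arbitrary: p f N M k rule: less_induct)
  case less
  obtain b0 S0 where b0: "play b0 = p" "step (N, M) b0 S0"
    using scheduled_root_step less.prems by metis
  \<comment> \<open>A complete computation cannot end in a session that has a transition.\<close>
  then have "x \<noteq> enat k"
    using assms(1) less.prems(2) unfolding complete_lockstep_def by metis
  then have k: "enat k < x" using less.prems(3) by simp
  then have "lockstep (N, M) (Ds k) (Ss (Suc k))"
    using assms(1) less.prems(2) unfolding complete_lockstep_def by metis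
  then obtain bs where bs: "maximal_coherent (N, M) (Ds k)" "set bs = Ds k"
    "steps (N, M) bs (Ss (Suc k))"
    unfolding lockstep_def by blast
  have p: "p \<in> play ` set bs" using maximal_coherent_player bs b0 by metis
  show ?case
  proof (cases "r \<in> play ` Ds k")
    case True
    then obtain b where "b \<in> Ds k" "play b = r" by blast
    moreover from this have "\<exists>S'. step (N, M) b S'"
      using bs(1) unfolding maximal_coherent_def coherent_def by blast
    ultimately show ?thesis using k less.prems(2) by blast
  next
    case False
    obtain N' M' where N': "Ss (Suc k) = (N', M')" by force
    obtain p' f' where "N' r = N r" "scheduled p' f' N' M'" "f' r < f r"
      using scheduled_steps[of N M bs N' M' p f r] bs p N' False less.prems by auto
    moreover have "enat (Suc k) \<le> x" using k by (simp add: Suc_ile_eq)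
    ultimately show ?thesis using less.hyps[of f' p' N' M' "Suc k"] N' less.prems(4) by auto
  qed
qed

lemma scheduled_input_enabling:
  assumes "scheduled p f N M"
  shows "input_enabling N M"
  unfolding input_enabling_def
proof (intro allI impI)
  fix r q Ps x Ss Ds
  assume r: "N r = Recv q Ps" and c: "complete_lockstep (N, M) x Ss Ds"
  then have "Ss 0 = (N, M)" by (simp add: complete_lockstep_def)
  from scheduled_eventually_moves[OF c assms this, of r] r
  obtain h N' M' b S' where h: "enat h < x" "b \<in> Ds h" "N' r = Recv q Ps" "play b = r"
    "step (N', M') b S'"
    by (auto simp flip: zero_enat_def)
  \<comment> \<open>At its first move \<open>r\<close> still offers the original input, so an
    enabled \<open>b\<close> with player \<open>r\<close> is an input with a label of
    \<open>Ps\<close>.\<close>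
  from h(5) have "\<exists>l\<in>fmdom' Ps. b = CIn q r l"
    using h(3,4) by cases (auto intro: fmdom'I)
  then show "\<exists>h. enat h < x \<and> (\<exists>l\<in>fmdom' Ps. CIn q r l \<in> Ds h)" using h by blast
qed

section \<open>Bounded, weakly balanced types yield schedules\<close>

text \<open>Witness that a global type has a path, needed because the supremum over an empty set of
  paths would be 0. The nonemptiness of branchings makes both \<open>SOME\<close> and
  \<open>the\<close> meaningful.\<close>

primcorec some_path :: "('p, 'l) gtype \<Rightarrow> ('p, 'l) comm trace" where
  "some_path G = (case G of End \<Rightarrow> TNil
    | GOut p q Gs \<Rightarrow> let l = (SOME l. l \<in> fmdom' Gs) in
        TCons (COut p q l) (some_path (the (fmlookup Gs l)))
    | GIn p q Gs \<Rightarrow> let l = (SOME l. l \<in> fmdom' Gs) in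
        TCons (CIn p q l) (some_path (the (fmlookup Gs l))))"

lemma gsubterm_trans:
  assumes "gsubterm G2 G3" and "gsubterm G1 G2"
  shows "gsubterm G1 G3"
  using assms by (induction rule: gsubterm.induct) (auto intro: gsubterm.intros)

lemma global_type_subterm: "global_type G \<Longrightarrow> gsubterm G' G \<Longrightarrow> global_type G'"
  unfolding global_type_def
  using gsubterm_trans finite_subset[of "{H. gsubterm H G'}" "{H. gsubterm H G}"] by blast

lemma bounded_gtype_subterm: "bounded_gtype G \<Longrightarrow> gsubterm G' G \<Longrightarrow> bounded_gtype G'"
  unfolding bounded_gtype_def using gsubterm_trans by blast

lemma gsubterm_branch:
  "fmlookup Gs l = Some G \<Longrightarrow> gsubterm G (GOut p q Gs)"
  "fmlookup Gs l = Some G \<Longrightarrow> gsubterm G (GIn p q Gs)"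
  by (auto intro: gsubterm.intros)

lemma global_type_nonempty:
  "global_type (GOut p q Gs) \<Longrightarrow> Gs \<noteq> fmempty"
  "global_type (GIn p q Gs) \<Longrightarrow> Gs \<noteq> fmempty"
  unfolding global_type_def by (blast intro: gsubterm.intros)+

lemma fmdom'_some_branch:
  assumes "Gs \<noteq> fmempty"
  shows "\<exists>G. fmlookup Gs (SOME l. l \<in> fmdom' Gs) = Some G"
proof -
  have "fmdom' Gs \<noteq> {}" using assms by (metis fmrestrict_set_dom fmrestrict_set_null)
  then have "(SOME l. l \<in> fmdom' Gs) \<in> fmdom' Gs" by (simp add: some_in_eq)
  then show ?thesis by (auto simp: fmlookup_dom'_iff)
qed

lemma is_path_some_path: "global_type G \<Longrightarrow> is_path G (some_path G)"
proof (coinduction arbitrary: G)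
  case is_path
  show ?case
  proof (cases G)
    case End
    then show ?thesis by (simp add: some_path.code)
  next
    case (GOut p q Gs)
    then obtain G' where "fmlookup Gs (SOME l. l \<in> fmdom' Gs) = Some G'"
      using is_path global_type_nonempty(1) fmdom'_some_branch by metis
    moreover from this have "global_type G'"
      using is_path GOut global_type_subterm gsubterm_branch(1) by metis
    moreover have "some_path G = TCons (COut p q (SOME l. l \<in> fmdom' Gs))
        (some_path (the (fmlookup Gs (SOME l. l \<in> fmdom' Gs))))"
      using GOut by (subst some_path.code) (simp add: Let_def)
    ultimately show ?thesis using GOut by auto
  next
    case (GIn p q Gs)
    then obtain G' where "fmlookup Gs (SOME l. l \<in> fmdom' Gs) = Some G'"
      using is_path global_type_nonempty(2) fmdom'_some_branch by metis
    moreover from this have "global_type G'"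
      using is_path GIn global_type_subterm gsubterm_branch(2) by metis
    moreover have "some_path G = TCons (CIn p q (SOME l. l \<in> fmdom' Gs))
        (some_path (the (fmlookup Gs (SOME l. l \<in> fmdom' Gs))))"
      using GIn by (subst some_path.code) (simp add: Let_def)
    ultimately show ?thesis using GIn by auto
  qed
qed

lemma tdepth_TCons: "play c \<noteq> r \<Longrightarrow> tdepth xs r + 1 \<le> tdepth (TCons c xs) r"
  unfolding tdepth_def
proof (rule Inf_greatest, clarify)
  fix n b
  assume *: "play c \<noteq> play b" "tnth (TCons c xs) n = Some b"
  then obtain m where "n = Suc m" "tnth xs m = Some b" by (cases n) auto
  then have "Inf {enat n |n. \<exists>b'. tnth xs n = Some b' \<and> play b' = play b} \<le> enat m"
    by (intro Inf_lower) blast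
  then have "Inf {enat n |n. \<exists>b'. tnth xs n = Some b' \<and> play b' = play b} + 1 \<le> enat m + 1"
    by (rule add_right_mono)
  then show "Inf {enat n |n. \<exists>b'. tnth xs n = Some b' \<and> play b' = play b} + 1 \<le> enat n"
    using \<open>n = Suc m\<close> by (simp add: one_enat_def)
qed

text \<open>Prefixing \<open>c\<close> turns paths of \<open>G'\<close> into paths of
  \<open>G\<close> and delays \<open>r\<close> by at least one position. Finiteness of the depth
  lets this inequality survive \<open>the_enat\<close>.\<close>

lemma depth_branch_less:
  assumes "global_type G'" and "r \<in> gplays G" and "r \<in> gplays G'" and "depth G r < \<infinity>"
    and "play c \<noteq> r" and "\<And>xs. is_path G' xs \<Longrightarrow> is_path G (TCons c xs)"
  shows "the_enat (depth G' r) < the_enat (depth G r)"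
proof -
  obtain n where n: "(SUP xs\<in>Paths G. tdepth xs r) = enat n"
    using assms(2,4) unfolding depth_def
    by (metis enat_ord_simps(4) less_infinityE plus_enat_simps(3))
  have le: "tdepth xs r + 1 \<le> enat n" if "is_path G' xs" for xs
  proof -
    have "tdepth xs r + 1 \<le> tdepth (TCons c xs) r" using assms(5) by (rule tdepth_TCons)
    also have "\<dots> \<le> enat n"
      unfolding n[symmetric] using assms(6)[OF that] by (intro SUP_upper) (simp add: Paths_def)
    finally show ?thesis .
  qed
  \<comment> \<open>An actual path of \<open>G'\<close> forces \<open>n\<close> to be
    positive.\<close>
  obtain m where m: "n = Suc m"
    using le[OF is_path_some_path[OF assms(1)]]
    by (cases n; cases "tdepth (some_path G') r") (auto simp: one_enat_def)
  have "tdepth xs r \<le> enat m" if "is_path G' xs" for xs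
    using le[OF that] m by (cases "tdepth xs r") (auto simp: one_enat_def)
  then have "(SUP xs\<in>Paths G'. tdepth xs r) \<le> enat m"
    by (intro SUP_least) (simp add: Paths_def)
  then obtain k where "(SUP xs\<in>Paths G'. tdepth xs r) = enat k" "k \<le> m"
    by (metis enat_ile enat_ord_simps(1))
  then show ?thesis using assms(2,3) n m by (simp add: depth_def one_enat_def)
qed

text \<open>The value at \<open>End\<close> is arbitrary, since \<open>scheduled_End\<close> holds
  for every root.\<close>

fun root_player :: "('p, 'l) gtype \<Rightarrow> 'p" where
  "root_player End = undefined"
| "root_player (GOut p q Gs) = p"
| "root_player (GIn p q Gs) = q"

text \<open>Coinduction with depths as ranks. The typing condition on players keeps every active
  participant other than the root in each branch, so its depth decreases; weak balancing supplies
  the message for each input.\<close>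

lemma typing_scheduled:
  fixes G :: "('p, 'l) gtype"
  assumes "global_type G" and "bounded_gtype G" and "\<turnstile> G \<triangleright> N" and "weakly_balanced G M"
  shows "scheduled (root_player G) (\<lambda>r. the_enat (depth G r)) N M"
proof -
  define R where "R p f N M \<longleftrightarrow> (\<exists>G. global_type G \<and> bounded_gtype G \<and> (\<turnstile> G \<triangleright> N) \<and>
    weakly_balanced G M \<and> p = root_player G \<and> f = (\<lambda>r. the_enat (depth G r)))"
    for p f and N :: "('p, 'l) net" and M
  have "R (root_player G) (\<lambda>r. the_enat (depth G r)) N M"
    unfolding R_def using assms by blast
  then show ?thesis
  proof (coinduct rule: scheduled.coinduct)
    case (scheduled p0 f N M)
    then obtain G where G: "global_type G" "bounded_gtype G"
      and typed: "\<turnstile> G \<triangleright> N" and bal: "weakly_balanced G M"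
      and p0: "p0 = root_player G" and f: "f = (\<lambda>r. the_enat (depth G r))"
      unfolding R_def by blast
    have finite_depth: "depth G r < \<infinity>" if "r \<in> gplays G" for r
      using G(2) that unfolding bounded_gtype_def by (blast intro: gsubterm.intros)
    show ?case
      using typed
    proof cases
      case typing_End
      then show ?thesis by simp
    next
      case (typing_Out N0 p Gs Ps q)
      have branch: "\<exists>p' f'. R p' f' (N(p := P)) (M \<cdot> qsingle (p, l, q)) \<and>
          (\<forall>r. r \<noteq> p \<longrightarrow> N r \<noteq> Inact \<longrightarrow> f' r < f r)"
        if P: "fmlookup Ps l = Some P" for l P
      proof -
        obtain G' where G': "fmlookup Gs l = Some G'"
          using P typing_Out(4) by (metis fmdom'I fmlookup_dom'_iff)
        have sub: "global_type G'" "bounded_gtype G'"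
          using G G' typing_Out(1) gsubterm_branch(1) global_type_subterm bounded_gtype_subterm
          by metis+
        have t: "\<turnstile> G' \<triangleright> (N0(p := P))" "gplays G' - {p} = nplays N0"
          using typing_Out(5) G' P by auto
        have wb: "weakly_balanced G' (M \<cdot> qsingle (p, l, q))"
          using bal G' typing_Out(1) by (auto elim: weakly_balanced.cases)
        have "the_enat (depth G' r) < f r" if "r \<noteq> p" "N r \<noteq> Inact" for r
          unfolding f
        proof (rule depth_branch_less)
          \<comment> \<open>\<open>nplays N0\<close> consists of the active participants other than
            \<open>p\<close>, and typing makes all of them players of the branch.\<close>
          show r: "r \<in> gplays G'" using that t(2) typing_Out(2) by (auto simp: nplays_def)
          then show "r \<in> gplays G"
            using G' typing_Out(1) by (auto simp: gplays_def intro: in_gplays.intros)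
          then show "depth G r < \<infinity>" by (rule finite_depth)
          show "play (COut p q l) \<noteq> r" using that by simp
        qed (use sub G' typing_Out(1) in \<open>auto intro: is_path.intros\<close>)
        moreover have "R (root_player G') (\<lambda>r. the_enat (depth G' r)) (N(p := P))
            (M \<cdot> qsingle (p, l, q))"
          unfolding R_def using sub t(1) wb typing_Out(2) by auto
        ultimately show ?thesis by blast
      qed
      have "Ps \<noteq> fmempty"
        using G(1) typing_Out(1,4) global_type_nonempty(1)
        by (metis fmdom'_empty fmrestrict_set_dom fmrestrict_set_null)
      moreover have "N p = Send q Ps" "p0 = p" using typing_Out p0 by auto
      moreover have "\<forall>l P. fmlookup Ps l = Some P \<longrightarrow>
          (\<exists>p' f'. (R p' f' (N(p := P)) (M \<cdot> qsingle (p, l, q)) \<or>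
              scheduled p' f' (N(p := P)) (M \<cdot> qsingle (p, l, q))) \<and>
            (\<forall>r. r \<noteq> p \<longrightarrow> N r \<noteq> Inact \<longrightarrow> f' r < f r))"
        using branch by blast
      ultimately show ?thesis by (simp del: fun_upd_apply)
    next
      case (typing_In N0 p Gs Ps q)
      \<comment> \<open>Weak balancing selects the one branch whose message is available; the other
        branches are dropped.\<close>
      obtain l G' M' where G': "fmlookup Gs l = Some G'" "weakly_balanced G' M'"
        "M = qsingle (q, l, p) \<cdot> M'"
        using bal typing_In(1) by (auto elim: weakly_balanced.cases)
      then obtain P where P: "fmlookup Ps l = Some P"
        using typing_In(4) by (metis fmdom'I fmlookup_dom'_iff subsetD)
      have sub: "global_type G'" "bounded_gtype G'"
        using G G' typing_In(1) gsubterm_branch(2) global_type_subterm bounded_gtype_subterm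
        by metis+
      have t: "\<turnstile> G' \<triangleright> (N0(p := P))" "gplays G' - {p} = nplays N0"
        using typing_In(5) G' P by auto
      have "the_enat (depth G' r) < f r" if "r \<noteq> p" "N r \<noteq> Inact" for r
        unfolding f
      proof (rule depth_branch_less)
        show r: "r \<in> gplays G'" using that t(2) typing_In(2) by (auto simp: nplays_def)
        then show "r \<in> gplays G"
          using G' typing_In(1) by (auto simp: gplays_def intro: in_gplays.intros)
        then show "depth G r < \<infinity>" by (rule finite_depth)
        show "play (CIn q p l) \<noteq> r" using that by simp
      qed (use sub G' typing_In(1) in \<open>auto intro: is_path.intros\<close>)
      moreover have "R (root_player G') (\<lambda>r. the_enat (depth G' r)) (N(p := P)) M'"
        unfolding R_def using sub t(1) G'(2) typing_In(2) by auto
      ultimately have "\<exists>l P p' f' M'. M = qsingle (q, l, p) \<cdot> M' \<and> fmlookup Ps l = Some P \<and>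
          (R p' f' (N(p := P)) M' \<or> scheduled p' f' (N(p := P)) M') \<and>
          (\<forall>r. r \<noteq> p \<longrightarrow> N r \<noteq> Inact \<longrightarrow> f' r < f r)"
        using G'(3) P by blast
      moreover have "N p = Recv q Ps" "p0 = p" using typing_In p0 by auto
      ultimately show ?thesis
        by (simp del: fun_upd_apply)
    qed
  qed
qed

theorem theorem4p12:
  fixes G :: "('p, 'l) gtype"
    and N :: "('p, 'l) net"
    and M :: "('p, 'l) queue"
  assumes "global_type G"
    and "network N"
    and "\<turnstile> G \<triangleright> N"
    and "bounded_gtype G"
    and "weakly_balanced G M"
  shows "input_enabling N M"
  using scheduled_input_enabling[OF typing_scheduled] assms(1,3,4,5) by blast

end
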